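(* Let $\Omega$ be a finite set with $|\Omega|\ge2$, let $P=(p(x,y))_{x,y\in\Omega}$ be a Markov kernel on $\Omega$ that is reversible with respect to $\pi$, assume $p_*:=\min_{x,y\in\Omega}p(x,y)>0$, and set $$\kappa(P):=\frac{p_*^4\bigl(1-\sqrt{\delta(P)}\bigr)^2}{4}.$$ Fix an integer $n\ge2$ and let $U=(U_1,\dots,U_n)$ have law $\mu_n$. Let $d\ge1$ and let $g:\Omega\to\mathbb H_d$ satisfy $\max_{x\in\Omega}\|g(x)\|\le1$. Then $$\mathbb P_{\mu_n}\left(\left\|\frac1n\sum_{i=1}^n g(U_i)-\pi(g)\right\|\ge t\right)\le 6d\exp\left(-\sqrt{\frac{\kappa(P)n}{2}}\;t\right),\qquad t>0,$$ and $$\mathbb E_{\mu_n}\left\|\frac1n\sum_{i=1}^n g(U_i)-\pi(g)\right\|\le\log(6\mathrm e d)\sqrt{\frac{2}{\kappa(P)n}}.$$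
   Context: $\pi$ is the stationary distribution of $P$; reversibility means $\pi(x)p(x,y)=\pi(y)p(y,x)$ for all $x,y$. $\mathbb H_d$ is the real vector space of $d\times d$ Hermitian matrices, $\|\cdot\|$ is the $\ell_2$ operator norm, $\pi(g)=\sum_{x\in\Omega}\pi(x)g(x)$, $\log$ is the natural logarithm and $\mathrm e=\exp(1)$. The Dobrushin coefficient is $\delta(P)=\max_{x,y\in\Omega}\frac12\sum_{z\in\Omega}|p(x,z)-p(y,z)|$ (which is $<1$ when $p_*>0$). The stationary path law on $\Omega^n$ is $\mu_n(u_1,\dots,u_n)=\pi(u_1)\prod_{i=1}^{n-1}p(u_i,u_{i+1})$. *)

theory Defs
  imports "HOL-Probability.Probability"
begin

section \<open>Finite Markov kernels\<close>

definition markov_kernel :: "'a set \<Rightarrow> ('a \<Rightarrow> 'a \<Rightarrow> real) \<Rightarrow> bool" where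
  "markov_kernel \<Omega> p \<longleftrightarrow> (\<forall>x\<in>\<Omega>. (\<forall>y\<in>\<Omega>. 0 \<le> p x y) \<and> (\<Sum>y\<in>\<Omega>. p x y) = 1)"

definition stationary_distribution :: "'a set \<Rightarrow> ('a \<Rightarrow> 'a \<Rightarrow> real) \<Rightarrow> ('a \<Rightarrow> real) \<Rightarrow> bool" where
  "stationary_distribution \<Omega> p \<pi> \<longleftrightarrow>
     (\<forall>x\<in>\<Omega>. 0 \<le> \<pi> x) \<and> (\<Sum>x\<in>\<Omega>. \<pi> x) = 1 \<and>
     (\<forall>y\<in>\<Omega>. (\<Sum>x\<in>\<Omega>. \<pi> x * p x y) = \<pi> y)"

definition reversible_kernel :: "'a set \<Rightarrow> ('a \<Rightarrow> 'a \<Rightarrow> real) \<Rightarrow> ('a \<Rightarrow> real) \<Rightarrow> bool" where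
  "reversible_kernel \<Omega> p \<pi> \<longleftrightarrow> (\<forall>x\<in>\<Omega>. \<forall>y\<in>\<Omega>. \<pi> x * p x y = \<pi> y * p y x)"

definition min_entry :: "'a set \<Rightarrow> ('a \<Rightarrow> 'a \<Rightarrow> real) \<Rightarrow> real" where
  "min_entry \<Omega> p = Min ((\<lambda>(x, y). p x y) ` (\<Omega> \<times> \<Omega>))"

definition dobrushin :: "'a set \<Rightarrow> ('a \<Rightarrow> 'a \<Rightarrow> real) \<Rightarrow> real" where
  "dobrushin \<Omega> p = Max ((\<lambda>(x, y). 1 / 2 * (\<Sum>z\<in>\<Omega>. \<bar>p x z - p y z\<bar>)) ` (\<Omega> \<times> \<Omega>))"

definition kappa :: "'a set \<Rightarrow> ('a \<Rightarrow> 'a \<Rightarrow> real) \<Rightarrow> real" where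
  "kappa \<Omega> p = min_entry \<Omega> p ^ 4 * (1 - sqrt (dobrushin \<Omega> p))\<^sup>2 / 4"

text \<open>
  The set \<open>\<Omega>\<^sup>n\<close> is represented by the extensional functions from \<open>{1..n}\<close> to \<open>\<Omega>\<close>.
  The path law carries the full power set as sigma-algebra.
\<close>

definition path_set :: "'a set \<Rightarrow> nat \<Rightarrow> (nat \<Rightarrow> 'a) set" where
  "path_set \<Omega> n = (\<Pi>\<^sub>E i\<in>{1..n}. \<Omega>)"

definition path_law ::
  "'a set \<Rightarrow> ('a \<Rightarrow> 'a \<Rightarrow> real) \<Rightarrow> ('a \<Rightarrow> real) \<Rightarrow> nat \<Rightarrow> (nat \<Rightarrow> 'a) measure" where
  "path_law \<Omega> p \<pi> n =
     point_measure (path_set \<Omega> n)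
       (\<lambda>u. ennreal (\<pi> (u 1) * (\<Prod>i = 1..n - 1. p (u i) (u (i + 1)))))"

section \<open>Matrix-valued observables\<close>

definition hermitian :: "complex ^ 'd ^ 'd \<Rightarrow> bool" where
  "hermitian A \<longleftrightarrow> (\<forall>i j. A $ i $ j = cnj (A $ j $ i))"

text \<open>
  The norm of the library on \<^typ>\<open>complex ^ 'd ^ 'd\<close> is the Frobenius norm, so the
  \<open>\<ell>\<^sub>2\<close> operator norm has to be taken explicitly; the norm on \<^typ>\<open>complex ^ 'd\<close>
  is the Euclidean one.
\<close>

definition op_norm :: "complex ^ 'd ^ 'd \<Rightarrow> real" where
  "op_norm A = onorm (\<lambda>v. A *v v)"

definition stationary_mean ::
  "'a set \<Rightarrow> ('a \<Rightarrow> real) \<Rightarrow> ('a \<Rightarrow> complex ^ 'd ^ 'd) \<Rightarrow> complex ^ 'd ^ 'd" where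
  "stationary_mean \<Omega> \<pi> g = (\<Sum>x\<in>\<Omega>. \<pi> x *\<^sub>R g x)"

definition empirical_mean ::
  "nat \<Rightarrow> ('a \<Rightarrow> complex ^ 'd ^ 'd) \<Rightarrow> (nat \<Rightarrow> 'a) \<Rightarrow> complex ^ 'd ^ 'd" where
  "empirical_mean n g u = (1 / real n) *\<^sub>R (\<Sum>i = 1..n. g (u i))"

end

theory Submission
  imports Defs
begin

text \<open>
  A Hermitian \<open>d \<times> d\<close> matrix is a self-adjoint operator on a real Euclidean space of dimension
  \<open>2 d\<close>. Comparing \<open>A\<close> and \<open>B\<close> in their eigenbases, a second-order Taylor bound for \<open>cosh\<close>
  yields \<open>tr cosh B \<le> tr cosh A + tr ((B - A) sinh A) + R\<^sup>2 / 2 (tr cosh A + tr cosh B)\<close> if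
  \<open>\<parallel>B - A\<parallel> \<le> R\<close>. Along a martingale with increments bounded by \<open>R\<close> the linear term has mean zero,
  so each step multiplies the mean of \<open>tr cosh\<close> by at most \<open>(1 + R\<^sup>2 / 2) / (1 - R\<^sup>2 / 2)\<close>; neither
  Golden--Thompson nor a Poincare inequality is needed. By Doeblin's contraction
  the Doob martingale of the scaled sum \<open>a (1/n \<Sum> g (U\<^sub>i) - \<pi>(g))\<close>, \<open>a = sqrt (\<kappa> n / 2)\<close>, has
  increments with \<open>R\<^sup>2 \<le> 1 / (32 n)\<close>, hence \<open>E exp (a \<parallel>1/n \<Sum> g (U\<^sub>i) - \<pi>(g)\<parallel>) \<le> 6 d\<close>. Both
  claims follow from this exponential moment.
\<close>

section \<open>The spectral theorem for self-adjoint operators\<close>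

definition self_adjoint :: "('v::real_inner \<Rightarrow>\<^sub>L 'v) \<Rightarrow> bool" where
  "self_adjoint A \<longleftrightarrow> (\<forall>x y. A x \<bullet> y = x \<bullet> A y)"

lemma self_adjoint_zero: "self_adjoint 0"
  by (simp add: self_adjoint_def)

lemma self_adjoint_add: "self_adjoint A \<Longrightarrow> self_adjoint B \<Longrightarrow> self_adjoint (A + B)"
  by (simp add: self_adjoint_def blinfun.add_left inner_add)

lemma self_adjoint_diff: "self_adjoint A \<Longrightarrow> self_adjoint B \<Longrightarrow> self_adjoint (A - B)"
  by (simp add: self_adjoint_def blinfun.diff_left inner_diff)

lemma self_adjoint_scaleR: "self_adjoint A \<Longrightarrow> self_adjoint (c *\<^sub>R A)"
  by (simp add: self_adjoint_def blinfun.scaleR_left)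

lemma self_adjoint_sum: "(\<And>i. i \<in> I \<Longrightarrow> self_adjoint (f i)) \<Longrightarrow> self_adjoint (sum f I)"
  by (induction I rule: infinite_finite_induct) (auto simp: self_adjoint_zero self_adjoint_add)

text \<open>First-variation argument: a quadratic in \<open>t\<close> that is maximal at
  \<open>t = 0\<close> has vanishing derivative there.\<close>

lemma linear_term_zero:
  fixes a b :: real
  assumes "\<And>t. 2 * t * a + t\<^sup>2 * b \<le> 0"
  shows "a = 0"
proof (rule ccontr)
  assume "a \<noteq> 0"
  \<comment> \<open>The test point \<open>t = s * a\<close> is small enough that
    \<open>s * \<bar>b\<bar> < 1\<close> keeps the quadratic term from outweighing the linear
    one.\<close>
  define s where "s = 1 / (1 + \<bar>b\<bar>)"
  have s: "s > 0" "s * \<bar>b\<bar> < 1" by (auto simp: s_def field_simps)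
  have "2 * (s * a) * a + (s * a)\<^sup>2 * b = s * a\<^sup>2 * (2 + s * b)"
    by (simp add: power2_eq_square algebra_simps)
  moreover have "2 + s * b > 0"
    using s by (smt (verit) abs_ge_minus_self mult_left_mono mult_minus_right)
  ultimately have "2 * (s * a) * a + (s * a)\<^sup>2 * b > 0"
    using s \<open>a \<noteq> 0\<close> by simp
  with assms[of "s * a"] show False by simp
qed

text \<open>Rayleigh's principle: a maximiser \<open>x\<close> of the quadratic form on the unit
  sphere of \<open>S\<close> is an eigenvector, since the form is stationary at \<open>x\<close> in
  the direction of the residual \<open>A x - c x\<close>, which stays in \<open>S\<close> by
  invariance.\<close>

lemma invariant_subspace_eigenvector:
  fixes A :: "'v::euclidean_space \<Rightarrow>\<^sub>L 'v"
  assumes sa: "self_adjoint A" and S: "subspace S" and inv: "\<And>x. x \<in> S \<Longrightarrow> A x \<in> S"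
    and w: "w \<in> S" "w \<noteq> 0"
  obtains x where "x \<in> S" "norm x = 1" "A x = (A x \<bullet> x) *\<^sub>R x"
proof -
  have "compact (S \<inter> sphere 0 1)"
    by (intro closed_Int_compact closed_subspace S) auto
  moreover have "w /\<^sub>R norm w \<in> S \<inter> sphere 0 1"
    using w S by (auto simp: subspace_scale)
  moreover have "continuous_on (S \<inter> sphere 0 1) (\<lambda>x. A x \<bullet> x)"
    by (intro continuous_intros)
  ultimately obtain x where x: "x \<in> S \<inter> sphere 0 1"
    and max: "\<And>y. y \<in> S \<inter> sphere 0 1 \<Longrightarrow> A y \<bullet> y \<le> A x \<bullet> x"
    using continuous_attains_sup[of "S \<inter> sphere 0 1" "\<lambda>x. A x \<bullet> x"] by blast
  define c where "c = A x \<bullet> x"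
  have xS: "x \<in> S" and nx: "x \<bullet> x = 1"
    using x by (auto simp: dot_square_norm)
  have quad: "A y \<bullet> y \<le> c * (y \<bullet> y)" if "y \<in> S" for y
  proof (cases "y = 0")
    case False
    have "A (y /\<^sub>R norm y) \<bullet> (y /\<^sub>R norm y) \<le> c"
      unfolding c_def using that False S by (intro max) (auto simp: subspace_scale)
    then show ?thesis
      using False by (simp add: blinfun.scaleR_right dot_square_norm field_simps power2_eq_square)
  qed simp
  define z where "z = A x - c *\<^sub>R x"
  have zS: "z \<in> S"
    unfolding z_def by (intro subspace_diff subspace_scale S inv xS)
  \<comment> \<open>Up to a factor 2 this is the derivative of
    \<open>A y \<bullet> y - c * (y \<bullet> y)\<close> at \<open>x\<close> in direction
    \<open>z\<close>; it also equals \<open>z \<bullet> z\<close>.\<close>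
  have "A x \<bullet> z - c * (x \<bullet> z) = 0"
  proof (rule linear_term_zero)
    fix t :: real
    have "A (x + t *\<^sub>R z) \<bullet> (x + t *\<^sub>R z) \<le> c * ((x + t *\<^sub>R z) \<bullet> (x + t *\<^sub>R z))"
      by (intro quad subspace_add subspace_scale S xS zS)
    moreover have "A z \<bullet> x = A x \<bullet> z"
      using sa by (metis inner_commute self_adjoint_def)
    ultimately show "2 * t * (A x \<bullet> z - c * (x \<bullet> z)) + t\<^sup>2 * (A z \<bullet> z - c * (z \<bullet> z)) \<le> 0"
      using nx
      by (simp add: blinfun.add_right blinfun.scaleR_right inner_add inner_commute[of z x]
          c_def[symmetric] power2_eq_square algebra_simps)
  qed
  then have "z \<bullet> z = 0"
    by (simp add: z_def inner_diff_left inner_diff_right algebra_simps)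
  then have "A x = c *\<^sub>R x" by (simp add: z_def)
  with that xS x show ?thesis unfolding c_def by auto
qed

section \<open>Orthonormal eigenbases and Parseval's identity\<close>

definition orthonormal_basis :: "'v::euclidean_space set \<Rightarrow> bool" where
  "orthonormal_basis B \<longleftrightarrow>
     finite B \<and> pairwise orthogonal B \<and> (\<forall>u\<in>B. norm u = 1) \<and> span B = UNIV"

text \<open>A fixed choice, meaningful for self-adjoint \<open>A\<close>. Eigenvalues are read off
  as \<open>A u \<bullet> u\<close>; indexing by the eigenvectors themselves accounts for
  multiplicity.\<close>

definition eigenbasis :: "('v::euclidean_space \<Rightarrow>\<^sub>L 'v) \<Rightarrow> 'v set" where
  "eigenbasis A = (SOME B. orthonormal_basis B \<and> (\<forall>u\<in>B. A u = (A u \<bullet> u) *\<^sub>R u))"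

text \<open>An orthonormal set of eigenvectors of maximal cardinality spans the space: its
  orthogonal complement is invariant under \<open>A\<close>, so a nonzero complement would contain
  one more unit eigenvector.\<close>

theorem self_adjoint_eigenbasis:
  fixes A :: "'v::euclidean_space \<Rightarrow>\<^sub>L 'v"
  assumes sa: "self_adjoint A"
  shows "\<exists>B. orthonormal_basis B \<and> (\<forall>u\<in>B. A u = (A u \<bullet> u) *\<^sub>R u)"
proof -
  define P where "P B \<longleftrightarrow> finite B \<and> pairwise orthogonal B \<and> (\<forall>u\<in>B. norm u = 1) \<and>
    (\<forall>u\<in>B. A u = (A u \<bullet> u) *\<^sub>R u)" for B
  have "card B < Suc DIM('v)" if "P B" for B
  proof -
    have "independent B"
      using that by (intro pairwise_orthogonal_independent) (auto simp: P_def)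
    then show ?thesis using independent_bound[of B] by (simp add: less_Suc_eq_le)
  qed
  moreover have "P {}" by (simp add: P_def pairwise_def)
  ultimately have "\<exists>B. P B \<and> (\<forall>C. P C \<longrightarrow> card C \<le> card B)"
    by (intro Lattices_Big.ex_has_greatest_nat[where b = "Suc DIM('v)"]) auto
  then obtain B where B: "P B" and max: "\<And>C. P C \<Longrightarrow> card C \<le> card B"
    by metis
  have "span B = UNIV"
  proof (rule ccontr)
    assume "span B \<noteq> UNIV"
    then obtain w where w: "w \<noteq> 0" "\<forall>x\<in>span B. w \<bullet> x = 0"
      using span_not_UNIV_orthogonal by blast
    define S where "S = {y. \<forall>u\<in>B. orthogonal u y}"
    have "A y \<in> S" if "y \<in> S" for y
      unfolding S_def
    proof safe
      fix u assume u: "u \<in> B"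
      then have "A u = (A u \<bullet> u) *\<^sub>R u" using B by (auto simp: P_def)
      then have "u \<bullet> A y = (A u \<bullet> u) * (u \<bullet> y)"
        using sa by (metis inner_scaleR_left self_adjoint_def)
      with u that show "orthogonal u (A y)" by (simp add: S_def orthogonal_def)
    qed
    moreover have "w \<in> S"
      using w by (auto simp: S_def orthogonal_def inner_commute span_base)
    ultimately obtain x where x: "x \<in> S" "norm x = 1" "A x = (A x \<bullet> x) *\<^sub>R x"
      using invariant_subspace_eigenvector[OF sa, of S w] w subspace_orthogonal_to_vectors[of B]
      unfolding S_def by blast
    have "x \<notin> B" using x by (auto simp: S_def orthogonal_def)
    have "P (insert x B)"
      using B x by (auto simp: P_def S_def pairwise_insert orthogonal_commute)
    from max[OF this] \<open>x \<notin> B\<close> B show False by (simp add: P_def)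
  qed
  with B show ?thesis by (auto simp: P_def orthonormal_basis_def)
qed

lemma
  fixes A :: "'v::euclidean_space \<Rightarrow>\<^sub>L 'v"
  assumes "self_adjoint A"
  shows orthonormal_eigenbasis: "orthonormal_basis (eigenbasis A)"
    and eigenbasis_eigenvector: "u \<in> eigenbasis A \<Longrightarrow> A u = (A u \<bullet> u) *\<^sub>R u"
  using someI_ex[OF self_adjoint_eigenbasis[OF assms]] by (auto simp: eigenbasis_def)

lemma orthonormal_basis_card:
  fixes B :: "'v::euclidean_space set"
  assumes "orthonormal_basis B"
  shows "card B = DIM('v)"
proof -
  have "independent B"
    using assms by (intro pairwise_orthogonal_independent) (auto simp: orthonormal_basis_def)
  with assms show ?thesis
    using dim_eq_card[of B UNIV] by (simp add: orthonormal_basis_def)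
qed

lemma parseval:
  assumes "orthonormal_basis B"
  shows "x \<bullet> y = (\<Sum>u\<in>B. (x \<bullet> u) * (y \<bullet> u))"
proof -
  have "(\<Sum>u\<in>B. (y \<bullet> u) *\<^sub>R u) = y"
    using assms by (intro orthonormal_basis_expand) (auto simp: orthonormal_basis_def)
  then have "x \<bullet> y = x \<bullet> (\<Sum>u\<in>B. (y \<bullet> u) *\<^sub>R u)" by simp
  then show ?thesis by (simp add: inner_sum_right mult.commute)
qed

section \<open>The trace of the hyperbolic cosine\<close>

definition tr_cosh :: "('v::euclidean_space \<Rightarrow>\<^sub>L 'v) \<Rightarrow> real" where
  "tr_cosh A = (\<Sum>u\<in>eigenbasis A. cosh (A u \<bullet> u))"

lemma tr_cosh_zero: "tr_cosh (0 :: 'v::euclidean_space \<Rightarrow>\<^sub>L 'v) = DIM('v)"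
  using orthonormal_basis_card[OF orthonormal_eigenbasis[OF self_adjoint_zero]]
  by (simp add: tr_cosh_def)

text \<open>The norm is the largest modulus of an eigenvalue,
  \<open>exp \<bar>s\<bar> \<le> 2 * cosh s\<close>, and by positivity one eigenvalue's contribution
  is at most the trace. Using \<open>cosh\<close> covers both ends of the spectrum at once.\<close>

lemma exp_norm_le_tr_cosh:
  fixes A :: "'v::euclidean_space \<Rightarrow>\<^sub>L 'v"
  assumes sa: "self_adjoint A"
  shows "exp (norm A) \<le> 2 * tr_cosh A"
proof -
  let ?B = "eigenbasis A"
  have B: "orthonormal_basis ?B" by (rule orthonormal_eigenbasis[OF sa])
  have "finite ?B" "?B \<noteq> {}"
    using orthonormal_basis_card[OF B] B by (auto simp: orthonormal_basis_def)
  then have "Max ((\<lambda>u. \<bar>A u \<bullet> u\<bar>) ` ?B) \<in> (\<lambda>u. \<bar>A u \<bullet> u\<bar>) ` ?B"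
    by (intro Max_in) auto
  then obtain k where k: "k \<in> ?B" and Max: "Max ((\<lambda>u. \<bar>A u \<bullet> u\<bar>) ` ?B) = \<bar>A k \<bullet> k\<bar>"
    by blast
  have max: "\<bar>A u \<bullet> u\<bar> \<le> \<bar>A k \<bullet> k\<bar>" if "u \<in> ?B" for u
    unfolding Max[symmetric] using that \<open>finite ?B\<close> by (intro Max_ge) auto
  have "norm A \<le> \<bar>A k \<bullet> k\<bar>"
  proof (rule norm_blinfun_bound)
    fix v
    have eig: "A v \<bullet> u = (A u \<bullet> u) * (v \<bullet> u)" if "u \<in> ?B" for u
      using eigenbasis_eigenvector[OF sa that] sa
      by (metis inner_scaleR_right self_adjoint_def)
    have "(norm (A v))\<^sup>2 = (\<Sum>u\<in>?B. (A u \<bullet> u)\<^sup>2 * (v \<bullet> u)\<^sup>2)"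
      using parseval[OF B, of "A v" "A v"]
      by (simp add: dot_square_norm eig power2_eq_square mult_ac)
    also have "\<dots> \<le> (\<Sum>u\<in>?B. (A k \<bullet> k)\<^sup>2 * (v \<bullet> u)\<^sup>2)"
      by (intro sum_mono mult_right_mono) (auto simp: abs_le_square_iff[symmetric] max)
    also have "\<dots> = (\<bar>A k \<bullet> k\<bar> * norm v)\<^sup>2"
      using parseval[OF B, of v v]
      by (simp add: power_mult_distrib sum_distrib_left[symmetric]
          power2_eq_square[symmetric] dot_square_norm)
    finally show "norm (A v) \<le> \<bar>A k \<bullet> k\<bar> * norm v"
      by (rule power2_le_imp_le) simp
  qed simp
  then have "exp (norm A) \<le> exp \<bar>A k \<bullet> k\<bar>" by simp
  also have "\<dots> \<le> 2 * cosh (A k \<bullet> k)"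
    by (cases "A k \<bullet> k \<ge> 0") (auto simp: cosh_field_def abs_if)
  also have "cosh (A k \<bullet> k) \<le> tr_cosh A"
    unfolding tr_cosh_def using k \<open>finite ?B\<close> by (intro member_le_sum) auto
  finally show ?thesis by simp
qed

text \<open>Taylor's formula with remainder \<open>cosh t\<close>: as \<open>t\<close> lies between
  \<open>a\<close> and \<open>b\<close>, \<open>cosh t\<close> is at most the larger of
  \<open>cosh a\<close> and \<open>cosh b\<close>, hence at most their sum.\<close>

lemma cosh_second_order:
  fixes a b :: real
  shows "cosh b \<le> cosh a + (b - a) * sinh a + (b - a)\<^sup>2 / 2 * (cosh a + cosh b)"
proof (cases "a = b")
  case False
  \<comment> \<open>\<open>D m\<close> is the derivative of \<open>cosh\<close> of order
    \<open>m\<close>.\<close>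
  define D :: "nat \<Rightarrow> real \<Rightarrow> real" where "D m = (if even m then cosh else sinh)" for m
  have "\<exists>t. (if b < a then b < t \<and> t < a else a < t \<and> t < b) \<and>
    cosh b = (\<Sum>m<2. (D m a / fact m) * (b - a) ^ m) + (D 2 t / fact 2) * (b - a)\<^sup>2"
    by (rule Taylor[where a = "min a b" and b = "max a b"])
       (use False in \<open>auto simp: D_def intro!: derivative_eq_intros\<close>)
  then obtain t where t: "if b < a then b < t \<and> t < a else a < t \<and> t < b"
    and eq: "cosh b = cosh a + (b - a) * sinh a + (b - a)\<^sup>2 / 2 * cosh t"
    by (auto simp: D_def numeral_2_eq_2 mult_ac)
  have "cosh t = cosh \<bar>t\<bar>" by simp
  also have "\<dots> \<le> cosh (max \<bar>a\<bar> \<bar>b\<bar>)"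
    using t by (subst cosh_real_nonneg_le_iff) (auto split: if_splits)
  also have "\<dots> \<le> cosh a + cosh b"
    by (auto simp: max_def)
  finally show ?thesis unfolding eq[symmetric]
    by (subst eq) (auto intro!: mult_left_mono)
qed simp

text \<open>
  Evaluated in the two eigenbases with the doubly stochastic weights \<open>(u \<bullet> v)\<^sup>2\<close>, the scalar
  inequality turns into its trace version.
\<close>

lemma tr_cosh_second_order:
  fixes A B :: "'v::euclidean_space \<Rightarrow>\<^sub>L 'v"
  assumes sA: "self_adjoint A" and sB: "self_adjoint B" and R: "norm (B - A) \<le> R"
  shows "tr_cosh B \<le> tr_cosh A + (\<Sum>u\<in>eigenbasis A. sinh (A u \<bullet> u) * ((B - A) u \<bullet> u))
    + R\<^sup>2 / 2 * (tr_cosh A + tr_cosh B)"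
proof -
  let ?U = "eigenbasis A" and ?V = "eigenbasis B"
  define a b w where "a u = A u \<bullet> u" and "b v = B v \<bullet> v" and "w u v = (u \<bullet> v)\<^sup>2" for u v
  have U: "orthonormal_basis ?U" and V: "orthonormal_basis ?V"
    by (rule orthonormal_eigenbasis; fact)+
  have wV: "(\<Sum>v\<in>?V. w u v) = 1" if "u \<in> ?U" for u
    using parseval[OF V, of u u] U that
    by (simp add: w_def power2_eq_square orthonormal_basis_def dot_square_norm)
  have wU: "(\<Sum>u\<in>?U. w u v) = 1" if "v \<in> ?V" for v
    using parseval[OF U, of v v] V that
    by (simp add: w_def power2_eq_square orthonormal_basis_def dot_square_norm inner_commute)
  have Au: "A u = a u *\<^sub>R u" if "u \<in> ?U" for u
    unfolding a_def by (rule eigenbasis_eigenvector[OF sA that])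
  have Bv: "B v = b v *\<^sub>R v" if "v \<in> ?V" for v
    unfolding b_def by (rule eigenbasis_eigenvector[OF sB that])
  have Bu: "B u \<bullet> v = b v * (u \<bullet> v)" if "v \<in> ?V" for u v
    using sB Bv[OF that] by (metis inner_scaleR_right self_adjoint_def)
  \<comment> \<open>These are the entries of \<open>B - A\<close> between the two eigenbases. Hence
    \<open>w u v * (b v - a u)\<^sup>2\<close> is a squared entry, and its sums over
    \<open>v\<close> or over \<open>u\<close> are squared norms of \<open>(B - A) u\<close> and
    \<open>(B - A) v\<close>.\<close>
  have dev: "(B - A) u \<bullet> v = (b v - a u) * (u \<bullet> v)" if "u \<in> ?U" "v \<in> ?V" for u v
    using that by (simp add: blinfun.diff_left inner_diff_left Au Bu algebra_simps)
  have sq: "(norm ((B - A) u))\<^sup>2 \<le> R\<^sup>2" if "norm u = 1" for u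
    using norm_blinfun[of "B - A" u] R that by (intro power_mono) auto
  have devU: "(\<Sum>v\<in>?V. w u v * (b v - a u)\<^sup>2) \<le> R\<^sup>2" if "u \<in> ?U" for u
    using parseval[OF V, of "(B - A) u" "(B - A) u"] sq[of u] U that
    by (simp add: dev w_def dot_square_norm power2_eq_square orthonormal_basis_def mult_ac)
  have devV: "(\<Sum>u\<in>?U. w u v * (b v - a u)\<^sup>2) \<le> R\<^sup>2" if "v \<in> ?V" for v
  proof -
    have "(B - A) v \<bullet> u = (b v - a u) * (u \<bullet> v)" if "u \<in> ?U" for u
      using dev[OF that \<open>v \<in> ?V\<close>] self_adjoint_diff[OF sB sA]
      by (metis inner_commute self_adjoint_def)
    then show ?thesis
      using parseval[OF U, of "(B - A) v" "(B - A) v"] sq[of v] V that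
      by (simp add: w_def dot_square_norm power2_eq_square orthonormal_basis_def mult_ac)
  qed
  have "tr_cosh B = (\<Sum>v\<in>?V. (\<Sum>u\<in>?U. w u v) * cosh (b v))"
    by (simp add: tr_cosh_def b_def wU)
  also have "\<dots> = (\<Sum>u\<in>?U. \<Sum>v\<in>?V. w u v * cosh (b v))"
    by (subst sum.swap) (simp add: sum_distrib_right)
  also have "\<dots> \<le> (\<Sum>u\<in>?U. \<Sum>v\<in>?V. w u v *
      (cosh (a u) + (b v - a u) * sinh (a u) + (b v - a u)\<^sup>2 / 2 * (cosh (a u) + cosh (b v))))"
    by (intro sum_mono mult_left_mono cosh_second_order) (simp add: w_def)
  \<comment> \<open>The remainder is split so that the half with \<open>cosh (a u)\<close> can be
    summed over \<open>v\<close> first and the half with \<open>cosh (b v)\<close> over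
    \<open>u\<close> first; each inner sum is then at most \<open>R\<^sup>2\<close>.\<close>
  also have "\<dots> = (\<Sum>u\<in>?U. (\<Sum>v\<in>?V. w u v) * cosh (a u))
      + (\<Sum>u\<in>?U. sinh (a u) * (\<Sum>v\<in>?V. w u v * (b v - a u)))
      + ((\<Sum>u\<in>?U. cosh (a u) * (\<Sum>v\<in>?V. w u v * (b v - a u)\<^sup>2)) / 2
       + (\<Sum>u\<in>?U. \<Sum>v\<in>?V. cosh (b v) * (w u v * (b v - a u)\<^sup>2)) / 2)"
    unfolding sum_distrib_left sum_distrib_right sum_divide_distrib sum.distrib[symmetric]
    by (intro sum.cong refl) (simp add: field_simps)
  also have "(\<Sum>u\<in>?U. (\<Sum>v\<in>?V. w u v) * cosh (a u)) = tr_cosh A"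
    by (simp add: tr_cosh_def a_def wV)
  also have "(\<Sum>u\<in>?U. sinh (a u) * (\<Sum>v\<in>?V. w u v * (b v - a u)))
      = (\<Sum>u\<in>?U. sinh (A u \<bullet> u) * ((B - A) u \<bullet> u))"
  proof (rule sum.cong[OF refl])
    fix u assume u: "u \<in> ?U"
    have "(B - A) u \<bullet> u = (\<Sum>v\<in>?V. w u v * (b v - a u))"
      using parseval[OF V, of "(B - A) u" u] u
      by (simp add: dev w_def power2_eq_square mult_ac)
    then show "sinh (a u) * (\<Sum>v\<in>?V. w u v * (b v - a u)) = sinh (A u \<bullet> u) * ((B - A) u \<bullet> u)"
      by (simp add: a_def)
  qed
  also have "(\<Sum>u\<in>?U. cosh (a u) * (\<Sum>v\<in>?V. w u v * (b v - a u)\<^sup>2)) \<le> R\<^sup>2 * tr_cosh A"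
  proof -
    have "(\<Sum>u\<in>?U. cosh (a u) * (\<Sum>v\<in>?V. w u v * (b v - a u)\<^sup>2)) \<le> (\<Sum>u\<in>?U. cosh (a u) * R\<^sup>2)"
      by (intro sum_mono mult_left_mono devU) auto
    then show ?thesis by (simp add: tr_cosh_def a_def sum_distrib_left mult.commute)
  qed
  also have "(\<Sum>u\<in>?U. \<Sum>v\<in>?V. cosh (b v) * (w u v * (b v - a u)\<^sup>2)) \<le> R\<^sup>2 * tr_cosh B"
  proof -
    have "(\<Sum>u\<in>?U. \<Sum>v\<in>?V. cosh (b v) * (w u v * (b v - a u)\<^sup>2))
        = (\<Sum>v\<in>?V. cosh (b v) * (\<Sum>u\<in>?U. w u v * (b v - a u)\<^sup>2))"
      by (subst sum.swap) (simp add: sum_distrib_left)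
    also have "\<dots> \<le> (\<Sum>v\<in>?V. cosh (b v) * R\<^sup>2)"
      by (intro sum_mono mult_left_mono devV) auto
    finally show ?thesis by (simp add: tr_cosh_def b_def sum_distrib_left mult.commute)
  qed
  finally show ?thesis by (simp add: algebra_simps add_divide_distrib)
qed

text \<open>Each \<open>B y\<close> is compared with the mean. The linear terms average to zero, and
  the part of the remainder containing \<open>tr_cosh (B y)\<close> is absorbed on the left, which
  produces the quotient and uses \<open>R\<^sup>2 / 2 < 1\<close>.\<close>

lemma tr_cosh_mean:
  fixes B :: "'a \<Rightarrow> 'v::euclidean_space \<Rightarrow>\<^sub>L 'v"
  assumes q: "\<And>y. y \<in> I \<Longrightarrow> 0 \<le> q y" "sum q I = 1"
    and sB: "\<And>y. y \<in> I \<Longrightarrow> self_adjoint (B y)"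
    and osc: "\<And>y z. y \<in> I \<Longrightarrow> z \<in> I \<Longrightarrow> norm (B y - B z) \<le> R"
    and R: "R\<^sup>2 / 2 < 1"
  shows "(\<Sum>y\<in>I. q y * tr_cosh (B y))
    \<le> (1 + R\<^sup>2 / 2) / (1 - R\<^sup>2 / 2) * tr_cosh (\<Sum>y\<in>I. q y *\<^sub>R B y)"
proof -
  define A where "A = (\<Sum>y\<in>I. q y *\<^sub>R B y)"
  have sA: "self_adjoint A"
    unfolding A_def by (intro self_adjoint_sum self_adjoint_scaleR sB)
  have dev: "norm (B y - A) \<le> R" if "y \<in> I" for y
  proof -
    \<comment> \<open>The deviation from the mean is an average of pairwise differences, so it
      inherits the oscillation bound \<open>R\<close> with the same constant.\<close>
    have "B y - A = (\<Sum>z\<in>I. q z *\<^sub>R (B y - B z))"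
      using q by (simp add: A_def scaleR_diff_right sum_subtractf scaleR_sum_left[symmetric])
    also have "norm \<dots> \<le> (\<Sum>z\<in>I. q z * R)"
      using q that by (intro sum_norm_le) (auto intro!: mult_left_mono osc)
    finally show ?thesis using q by (simp add: sum_distrib_right[symmetric])
  qed
  define l where "l C = (\<Sum>u\<in>eigenbasis A. sinh (A u \<bullet> u) * (C u \<bullet> u))" for C :: "'v \<Rightarrow>\<^sub>L 'v"
  have "(\<Sum>y\<in>I. q y * l (B y - A)) = l (\<Sum>y\<in>I. q y *\<^sub>R (B y - A))"
    unfolding l_def
    by (simp add: blinfun.sum_left blinfun.scaleR_left inner_sum_left sum_distrib_left mult_ac)
       (rule sum.swap)
  also have "(\<Sum>y\<in>I. q y *\<^sub>R (B y - A)) = 0"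
    using q by (simp add: A_def scaleR_diff_right sum_subtractf scaleR_sum_left[symmetric])
  finally have l0: "(\<Sum>y\<in>I. q y * l (B y - A)) = 0" by (simp add: l_def)
  have "(\<Sum>y\<in>I. q y * tr_cosh (B y))
      \<le> (\<Sum>y\<in>I. q y * (tr_cosh A + l (B y - A) + R\<^sup>2 / 2 * (tr_cosh A + tr_cosh (B y))))"
    unfolding l_def by (intro sum_mono mult_left_mono tr_cosh_second_order sA sB dev q)
  also have "\<dots> = (\<Sum>y\<in>I. q y) * ((1 + R\<^sup>2 / 2) * tr_cosh A) + (\<Sum>y\<in>I. q y * l (B y - A))
      + R\<^sup>2 / 2 * (\<Sum>y\<in>I. q y * tr_cosh (B y))"
    unfolding sum_distrib_left sum_distrib_right sum.distrib[symmetric]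
    by (intro sum.cong refl) (simp add: field_simps)
  finally have "(1 - R\<^sup>2 / 2) * (\<Sum>y\<in>I. q y * tr_cosh (B y)) \<le> (1 + R\<^sup>2 / 2) * tr_cosh A"
    by (simp add: l0 q algebra_simps)
  with R show ?thesis unfolding A_def[symmetric] by (simp add: field_simps)
qed

section \<open>Additive functionals of Markov chains\<close>

definition kernel_op :: "'a set \<Rightarrow> ('a \<Rightarrow> 'a \<Rightarrow> real) \<Rightarrow> ('a \<Rightarrow> 'v::real_vector) \<Rightarrow> 'a \<Rightarrow> 'v" where
  "kernel_op \<Omega> p h x = (\<Sum>y\<in>\<Omega>. p x y *\<^sub>R h y)"

text \<open>Doeblin's argument: the common part \<open>e\<close> of all rows cancels in differences.\<close>

lemma kernel_op_oscillation:
  fixes h :: "'a \<Rightarrow> 'v::real_normed_vector"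
  assumes row: "\<And>x. x \<in> \<Omega> \<Longrightarrow> (\<Sum>y\<in>\<Omega>. p x y) = 1"
    and e: "\<And>x y. x \<in> \<Omega> \<Longrightarrow> y \<in> \<Omega> \<Longrightarrow> e \<le> p x y"
    and osc: "\<And>x y. x \<in> \<Omega> \<Longrightarrow> y \<in> \<Omega> \<Longrightarrow> norm (h x - h y) \<le> R"
    and xy: "x \<in> \<Omega>" "y \<in> \<Omega>"
  shows "norm (kernel_op \<Omega> p h x - kernel_op \<Omega> p h y) \<le> (1 - real (card \<Omega>) * e) * R"
proof -
  \<comment> \<open>\<open>q x\<close> is the row \<open>p x\<close> with the common part
    \<open>e\<close> removed; its total mass is \<open>m\<close>.\<close>
  define q where "q x y = p x y - e" for x y
  define m where "m = 1 - real (card \<Omega>) * e"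
  have q: "0 \<le> q x y" if "x \<in> \<Omega>" "y \<in> \<Omega>" for x y
    using e[OF that] by (simp add: q_def)
  have sq: "sum (q x) \<Omega> = m" if "x \<in> \<Omega>" for x
    using row[OF that] by (simp add: q_def m_def sum_subtractf)
  have "m \<ge> 0" using sq[OF xy(1)] q xy by (metis sum_nonneg)
  define d where "d = kernel_op \<Omega> p h x - kernel_op \<Omega> p h y"
  have d: "d = (\<Sum>z\<in>\<Omega>. q x z *\<^sub>R h z) - (\<Sum>w\<in>\<Omega>. q y w *\<^sub>R h w)"
    by (simp add: d_def kernel_op_def q_def scaleR_diff_left sum_subtractf)
  have "norm d \<le> m * R"
  proof (cases "m = 0")
    case True
    have "finite \<Omega>" using row[OF xy(1)] sum.infinite by fastforce
    then have "q x z = 0 \<and> q y z = 0" if "z \<in> \<Omega>" for z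
      using True sq xy q that by (metis sum_nonneg_eq_0_iff)
    with True show ?thesis by (simp add: d)
  next
    case False
    \<comment> \<open>Multiplication by \<open>m\<close> turns both terms into sums against the
      product of the residual rows, which pairs \<open>h z\<close> with \<open>h w\<close>. Dividing
      by \<open>m\<close> afterwards is why \<open>m = 0\<close> is treated separately.\<close>
    have "m *\<^sub>R d = (\<Sum>w\<in>\<Omega>. q y w) *\<^sub>R (\<Sum>z\<in>\<Omega>. q x z *\<^sub>R h z)
        - (\<Sum>z\<in>\<Omega>. q x z) *\<^sub>R (\<Sum>w\<in>\<Omega>. q y w *\<^sub>R h w)"
      by (simp add: d sq xy scaleR_diff_right)
    also have "(\<Sum>w\<in>\<Omega>. q y w) *\<^sub>R (\<Sum>z\<in>\<Omega>. q x z *\<^sub>R h z)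
        = (\<Sum>z\<in>\<Omega>. \<Sum>w\<in>\<Omega>. (q x z * q y w) *\<^sub>R h z)"
      unfolding scaleR_sum_left scaleR_sum_right
      by (simp add: mult.commute)
    also have "(\<Sum>z\<in>\<Omega>. q x z) *\<^sub>R (\<Sum>w\<in>\<Omega>. q y w *\<^sub>R h w)
        = (\<Sum>z\<in>\<Omega>. \<Sum>w\<in>\<Omega>. (q x z * q y w) *\<^sub>R h w)"
      unfolding scaleR_sum_left scaleR_sum_right by simp (rule sum.swap)
    also have "(\<Sum>z\<in>\<Omega>. \<Sum>w\<in>\<Omega>. (q x z * q y w) *\<^sub>R h z)
        - (\<Sum>z\<in>\<Omega>. \<Sum>w\<in>\<Omega>. (q x z * q y w) *\<^sub>R h w)
        = (\<Sum>z\<in>\<Omega>. \<Sum>w\<in>\<Omega>. (q x z * q y w) *\<^sub>R (h z - h w))"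
      by (simp add: scaleR_diff_right sum_subtractf)
    also have "norm \<dots> \<le> (\<Sum>z\<in>\<Omega>. \<Sum>w\<in>\<Omega>. (q x z * q y w) * R)"
      using q xy osc by (intro sum_norm_le) (auto intro!: mult_left_mono)
    also have "\<dots> = m * (m * R)"
      by (simp add: sum_distrib_right[symmetric] sum_distrib_left[symmetric] sq xy)
    finally show ?thesis using False \<open>m \<ge> 0\<close> by simp
  qed
  then show ?thesis by (simp add: d_def m_def)
qed

text \<open>The conditional expectation of \<open>\<Sum>j<m. h (U\<^sub>j)\<close> for the chain started at \<open>U\<^sub>0 = x\<close>.\<close>

primrec potential ::
  "'a set \<Rightarrow> ('a \<Rightarrow> 'a \<Rightarrow> real) \<Rightarrow> ('a \<Rightarrow> 'v::real_vector) \<Rightarrow> nat \<Rightarrow> 'a \<Rightarrow> 'v" where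
  "potential \<Omega> p h 0 x = 0"
| "potential \<Omega> p h (Suc m) x = h x + kernel_op \<Omega> p (potential \<Omega> p h m) x"

text \<open>The bound \<open>R\<close> reproduces itself: \<open>h\<close> contributes
  \<open>card \<Omega> * e * R\<close>, and the kernel contracts the previous \<open>R\<close> to
  \<open>(1 - card \<Omega> * e) * R\<close>. Hence the bound is uniform in
  \<open>m\<close>.\<close>

lemma potential_oscillation:
  fixes h :: "'a \<Rightarrow> 'v::real_normed_vector"
  assumes row: "\<And>x. x \<in> \<Omega> \<Longrightarrow> (\<Sum>y\<in>\<Omega>. p x y) = 1"
    and e: "\<And>x y. x \<in> \<Omega> \<Longrightarrow> y \<in> \<Omega> \<Longrightarrow> e \<le> p x y"
    and osc: "\<And>x y. x \<in> \<Omega> \<Longrightarrow> y \<in> \<Omega> \<Longrightarrow> norm (h x - h y) \<le> real (card \<Omega>) * e * R"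
    and R: "0 \<le> R" and xy: "x \<in> \<Omega>" "y \<in> \<Omega>"
  shows "norm (potential \<Omega> p h m x - potential \<Omega> p h m y) \<le> R"
  using xy
proof (induction m arbitrary: x y)
  case (Suc m)
  have "norm (potential \<Omega> p h (Suc m) x - potential \<Omega> p h (Suc m) y)
      \<le> norm (h x - h y) + norm (kernel_op \<Omega> p (potential \<Omega> p h m) x - kernel_op \<Omega> p (potential \<Omega> p h m) y)"
    by (simp add: norm_diff_triangle_ineq)
  also have "\<dots> \<le> real (card \<Omega>) * e * R + (1 - real (card \<Omega>) * e) * R"
    by (intro add_mono osc kernel_op_oscillation row e Suc)
  finally show ?case by (simp add: algebra_simps)
qed (use R in simp)

text \<open>Averages under \<open>\<pi>\<close> are invariant under the kernel, so centring passes
  from \<open>h\<close> to all its potentials. This gives the Doob martingale the initial value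
  zero.\<close>

lemma potential_stationary_mean:
  assumes stat: "\<And>y. y \<in> \<Omega> \<Longrightarrow> (\<Sum>x\<in>\<Omega>. \<pi> x * p x y) = \<pi> y"
    and h: "(\<Sum>x\<in>\<Omega>. \<pi> x *\<^sub>R h x) = 0"
  shows "(\<Sum>x\<in>\<Omega>. \<pi> x *\<^sub>R potential \<Omega> p h m x) = 0"
proof (induction m)
  case (Suc m)
  have "(\<Sum>x\<in>\<Omega>. \<pi> x *\<^sub>R kernel_op \<Omega> p (potential \<Omega> p h m) x)
      = (\<Sum>y\<in>\<Omega>. (\<Sum>x\<in>\<Omega>. \<pi> x * p x y) *\<^sub>R potential \<Omega> p h m y)"
    unfolding kernel_op_def by (simp add: scaleR_sum_left scaleR_sum_right) (rule sum.swap)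
  with Suc show ?case by (simp add: scaleR_add_right sum.distrib h stat)
qed simp

lemma self_adjoint_kernel_op:
  "(\<And>y. y \<in> \<Omega> \<Longrightarrow> self_adjoint (h y)) \<Longrightarrow> self_adjoint (kernel_op \<Omega> p h x)"
  unfolding kernel_op_def by (intro self_adjoint_sum self_adjoint_scaleR)

lemma self_adjoint_potential:
  assumes "\<And>y. y \<in> \<Omega> \<Longrightarrow> self_adjoint (h y)" "x \<in> \<Omega>"
  shows "self_adjoint (potential \<Omega> p h m x)"
  using assms(2)
  by (induction m arbitrary: x)
     (auto simp: self_adjoint_zero intro!: self_adjoint_add self_adjoint_kernel_op assms(1))

text \<open>Real-valued form of the density in \<open>path_law\<close>, so that expectations become
  finite real sums.\<close>

definition path_weight :: "('a \<Rightarrow> 'a \<Rightarrow> real) \<Rightarrow> ('a \<Rightarrow> real) \<Rightarrow> nat \<Rightarrow> (nat \<Rightarrow> 'a) \<Rightarrow> real" where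
  "path_weight p \<pi> n u = \<pi> (u 1) * (\<Prod>i = 1..n - 1. p (u i) (u (i + 1)))"

text \<open>Splitting off the last coordinate is how conditioning on the first \<open>k\<close>
  steps enters.\<close>

lemma sum_path_set_Suc:
  fixes f :: "(nat \<Rightarrow> 'a) \<Rightarrow> 'b::comm_monoid_add"
  shows "sum f (path_set \<Omega> (Suc k)) = (\<Sum>u\<in>path_set \<Omega> k. \<Sum>y\<in>\<Omega>. f (u(Suc k := y)))"
proof -
  have "path_set \<Omega> (Suc k) = (\<lambda>(y, u). u(Suc k := y)) ` (\<Omega> \<times> path_set \<Omega> k)"
    by (simp add: path_set_def atLeastAtMostSuc_conv PiE_insert_eq)
  moreover have "inj_on (\<lambda>(y, u). u(Suc k := y)) (\<Omega> \<times> path_set \<Omega> k)"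
    unfolding path_set_def by (rule inj_combinator) simp
  ultimately have "sum f (path_set \<Omega> (Suc k)) = (\<Sum>(y, u)\<in>\<Omega> \<times> path_set \<Omega> k. f (u(Suc k := y)))"
    by (simp add: sum.reindex case_prod_unfold)
  then show ?thesis
    by (simp add: sum.cartesian_product[symmetric]) (rule sum.swap)
qed

text \<open>The Markov property. For \<open>k = 0\<close> the new coordinate would be weighted by
  \<open>\<pi>\<close> instead of a transition probability.\<close>

lemma path_weight_upd_Suc:
  assumes "k \<ge> 1"
  shows "path_weight p \<pi> (Suc k) (u(Suc k := y)) = path_weight p \<pi> k u * p (u k) y"
proof -
  obtain j where j: "k = Suc j" using assms by (cases k) auto
  have "(\<Prod>i = 1..j. p ((u(Suc k := y)) i) ((u(Suc k := y)) (i + 1))) = (\<Prod>i = 1..j. p (u i) (u (i + 1)))"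
    by (intro prod.cong) (auto simp: j)
  then show ?thesis by (simp add: path_weight_def j)
qed

lemma path_weight_nonneg:
  assumes "\<And>x. x \<in> \<Omega> \<Longrightarrow> 0 \<le> \<pi> x" "\<And>x y. x \<in> \<Omega> \<Longrightarrow> y \<in> \<Omega> \<Longrightarrow> 0 \<le> p x y"
    and "u \<in> path_set \<Omega> n" "n \<ge> 1"
  shows "0 \<le> path_weight p \<pi> n u"
  unfolding path_weight_def
  using assms by (intro mult_nonneg_nonneg prod_nonneg) (auto simp: path_set_def PiE_iff)

text \<open>
  The argument of \<open>tr_cosh\<close> is Doob's martingale of \<open>\<Sum>i\<le>k+m. h (U\<^sub>i)\<close> at time \<open>k\<close>;
  by the oscillation bound its increments have norm at most \<open>R\<close>.
\<close>

lemma path_tr_cosh_martingale: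
  fixes h :: "'a \<Rightarrow> 'v::euclidean_space \<Rightarrow>\<^sub>L 'v"
  assumes row: "\<And>x. x \<in> \<Omega> \<Longrightarrow> (\<Sum>y\<in>\<Omega>. p x y) = 1"
    and e: "\<And>x y. x \<in> \<Omega> \<Longrightarrow> y \<in> \<Omega> \<Longrightarrow> e \<le> p x y" and e0: "0 \<le> e"
    and pi: "\<And>x. x \<in> \<Omega> \<Longrightarrow> 0 \<le> \<pi> x" "(\<Sum>x\<in>\<Omega>. \<pi> x) = 1"
    and stat: "\<And>y. y \<in> \<Omega> \<Longrightarrow> (\<Sum>x\<in>\<Omega>. \<pi> x * p x y) = \<pi> y"
    and sa: "\<And>x. x \<in> \<Omega> \<Longrightarrow> self_adjoint (h x)"
    and h: "(\<Sum>x\<in>\<Omega>. \<pi> x *\<^sub>R h x) = 0"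
    and osc: "\<And>x y. x \<in> \<Omega> \<Longrightarrow> y \<in> \<Omega> \<Longrightarrow> norm (h x - h y) \<le> real (card \<Omega>) * e * R"
    and R: "0 \<le> R" "R\<^sup>2 / 2 < 1"
  shows "(\<Sum>u\<in>path_set \<Omega> (Suc k). path_weight p \<pi> (Suc k) u *
      tr_cosh ((\<Sum>i=1..Suc k. h (u i)) + kernel_op \<Omega> p (potential \<Omega> p h m) (u (Suc k))))
    \<le> ((1 + R\<^sup>2 / 2) / (1 - R\<^sup>2 / 2)) ^ Suc k * DIM('v)"
proof -
  let ?r = "(1 + R\<^sup>2 / 2) / (1 - R\<^sup>2 / 2)"
  note pos = potential_oscillation[OF row e osc R(1)]
  have p0: "0 \<le> p x y" if "x \<in> \<Omega>" "y \<in> \<Omega>" for x y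
    using e[OF that] e0 by linarith
  show ?thesis
  \<comment> \<open>\<open>m\<close> counts the steps still ahead after time \<open>Suc k\<close>.
    Going back one time step turns \<open>m\<close> into \<open>Suc m\<close>, so \<open>m\<close>
    has to vary.\<close>
  proof (induction k arbitrary: m)
    case 0
    \<comment> \<open>The first increment leads from the overall mean zero to the potential at the
      initial state; it costs one factor like every later one.\<close>
    have "(\<Sum>u\<in>path_set \<Omega> (Suc 0). path_weight p \<pi> (Suc 0) u *
        tr_cosh ((\<Sum>i=1..Suc 0. h (u i)) + kernel_op \<Omega> p (potential \<Omega> p h m) (u (Suc 0))))
      = (\<Sum>x\<in>\<Omega>. \<pi> x * tr_cosh (potential \<Omega> p h (Suc m) x))"
      unfolding sum_path_set_Suc by (simp add: path_set_def path_weight_def)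
    also have "\<dots> \<le> ?r * tr_cosh (\<Sum>x\<in>\<Omega>. \<pi> x *\<^sub>R potential \<Omega> p h (Suc m) x)"
      by (intro tr_cosh_mean pi self_adjoint_potential sa pos R(2))
    also have "(\<Sum>x\<in>\<Omega>. \<pi> x *\<^sub>R potential \<Omega> p h (Suc m) x) = 0"
      by (rule potential_stationary_mean[OF stat h])
    finally show ?case by (simp add: tr_cosh_zero)
  next
    case (Suc k)
    let ?S = "\<lambda>u. \<Sum>i=1..Suc k. h (u i)"
    have r0: "0 \<le> ?r" using R by simp
    \<comment> \<open>Given the past, \<open>S\<close> is fixed and only the potential at the next
      state varies. Its oscillation is the increment bound, and \<open>kernel_op\<close> supplies
      its conditional mean.\<close>
    have step: "(\<Sum>y\<in>\<Omega>. p x y * tr_cosh (S + potential \<Omega> p h (Suc m) y))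
        \<le> ?r * tr_cosh (S + kernel_op \<Omega> p (potential \<Omega> p h (Suc m)) x)"
      if x: "x \<in> \<Omega>" and S: "self_adjoint S" for x S
    proof -
      have "(\<Sum>y\<in>\<Omega>. p x y * tr_cosh (S + potential \<Omega> p h (Suc m) y))
          \<le> ?r * tr_cosh (\<Sum>y\<in>\<Omega>. p x y *\<^sub>R (S + potential \<Omega> p h (Suc m) y))"
        using x pos p0 by (intro tr_cosh_mean self_adjoint_add S self_adjoint_potential sa row R(2))
          (simp_all del: potential.simps)
      also have "(\<Sum>y\<in>\<Omega>. p x y *\<^sub>R (S + potential \<Omega> p h (Suc m) y))
          = S + kernel_op \<Omega> p (potential \<Omega> p h (Suc m)) x"
        using row[OF x]
        by (simp add: kernel_op_def scaleR_add_right sum.distrib scaleR_sum_left[symmetric]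
            del: potential.simps)
      finally show ?thesis .
    qed
    \<comment> \<open>The newest summand \<open>h y\<close> and the expected future after
      \<open>y\<close> merge into \<open>potential \<Omega> p h (Suc m) y\<close>.\<close>
    have "(\<Sum>u\<in>path_set \<Omega> (Suc (Suc k)). path_weight p \<pi> (Suc (Suc k)) u *
        tr_cosh ((\<Sum>i=1..Suc (Suc k). h (u i)) + kernel_op \<Omega> p (potential \<Omega> p h m) (u (Suc (Suc k)))))
      = (\<Sum>u\<in>path_set \<Omega> (Suc k). path_weight p \<pi> (Suc k) u *
          (\<Sum>y\<in>\<Omega>. p (u (Suc k)) y * tr_cosh (?S u + potential \<Omega> p h (Suc m) y)))"
    proof -
      have S: "(\<Sum>i=1..Suc (Suc k). h ((u(Suc (Suc k) := y)) i)) = ?S u + h y" for u y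
      proof -
        have "(\<Sum>i=1..Suc k. h ((u(Suc (Suc k) := y)) i)) = ?S u"
          by (intro sum.cong) auto
        then show ?thesis by simp
      qed
      have "path_weight p \<pi> (Suc (Suc k)) (u(Suc (Suc k) := y))
        = path_weight p \<pi> (Suc k) u * p (u (Suc k)) y" for u y
        by (rule path_weight_upd_Suc) simp
      then show ?thesis
        unfolding sum_path_set_Suc[of _ \<Omega> "Suc k"] S
        by (simp add: sum_distrib_left mult.assoc add.assoc)
    qed
    also have "\<dots> \<le> (\<Sum>u\<in>path_set \<Omega> (Suc k). path_weight p \<pi> (Suc k) u *
        (?r * tr_cosh (?S u + kernel_op \<Omega> p (potential \<Omega> p h (Suc m)) (u (Suc k)))))"
    proof (intro sum_mono mult_left_mono step self_adjoint_sum sa)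
      fix u assume u: "u \<in> path_set \<Omega> (Suc k)"
      then show "u i \<in> \<Omega>" if "i \<in> {1..Suc k}" for i
        using that by (auto simp: path_set_def)
      show "u (Suc k) \<in> \<Omega>" using u by (auto simp: path_set_def)
      show "0 \<le> path_weight p \<pi> (Suc k) u"
        using u pi p0 by (intro path_weight_nonneg[of \<Omega>]) auto
    qed
    also have "\<dots> = ?r * (\<Sum>u\<in>path_set \<Omega> (Suc k). path_weight p \<pi> (Suc k) u *
        tr_cosh (?S u + kernel_op \<Omega> p (potential \<Omega> p h (Suc m)) (u (Suc k))))"
      by (simp add: sum_distrib_left mult_ac del: potential.simps)
    also have "\<dots> \<le> ?r * (?r ^ Suc k * DIM('v))"
      by (intro mult_left_mono Suc.IH r0)
    finally show ?case by (simp add: mult.assoc)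
  qed
qed

text \<open>At the final time no steps remain, so the martingale is the sum itself and
  \<open>tr_cosh\<close> controls the exponential of its norm.\<close>

theorem path_exp_norm_sum:
  fixes h :: "'a \<Rightarrow> 'v::euclidean_space \<Rightarrow>\<^sub>L 'v"
  assumes row: "\<And>x. x \<in> \<Omega> \<Longrightarrow> (\<Sum>y\<in>\<Omega>. p x y) = 1"
    and e: "\<And>x y. x \<in> \<Omega> \<Longrightarrow> y \<in> \<Omega> \<Longrightarrow> e \<le> p x y" and e0: "0 \<le> e"
    and pi: "\<And>x. x \<in> \<Omega> \<Longrightarrow> 0 \<le> \<pi> x" "(\<Sum>x\<in>\<Omega>. \<pi> x) = 1"
    and stat: "\<And>y. y \<in> \<Omega> \<Longrightarrow> (\<Sum>x\<in>\<Omega>. \<pi> x * p x y) = \<pi> y"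
    and sa: "\<And>x. x \<in> \<Omega> \<Longrightarrow> self_adjoint (h x)"
    and h: "(\<Sum>x\<in>\<Omega>. \<pi> x *\<^sub>R h x) = 0"
    and osc: "\<And>x y. x \<in> \<Omega> \<Longrightarrow> y \<in> \<Omega> \<Longrightarrow> norm (h x - h y) \<le> real (card \<Omega>) * e * R"
    and R: "0 \<le> R" "R\<^sup>2 / 2 < 1" and n: "n \<ge> 1"
  shows "(\<Sum>u\<in>path_set \<Omega> n. path_weight p \<pi> n u * exp (norm (\<Sum>i=1..n. h (u i))))
    \<le> 2 * ((1 + R\<^sup>2 / 2) / (1 - R\<^sup>2 / 2)) ^ n * DIM('v)"
proof -
  obtain k where k: "n = Suc k" using n by (cases n) auto
  have p0: "0 \<le> p x y" if "x \<in> \<Omega>" "y \<in> \<Omega>" for x y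
    using e[OF that] e0 by linarith
  have "(\<Sum>u\<in>path_set \<Omega> n. path_weight p \<pi> n u * exp (norm (\<Sum>i=1..n. h (u i))))
      \<le> (\<Sum>u\<in>path_set \<Omega> n. path_weight p \<pi> n u * (2 * tr_cosh (\<Sum>i=1..n. h (u i))))"
  proof (intro sum_mono mult_left_mono exp_norm_le_tr_cosh self_adjoint_sum sa)
    fix u assume u: "u \<in> path_set \<Omega> n"
    then show "u i \<in> \<Omega>" if "i \<in> {1..n}" for i
      using that by (auto simp: path_set_def)
    show "0 \<le> path_weight p \<pi> n u"
      using u pi p0 n by (intro path_weight_nonneg[of \<Omega>]) auto
  qed
  \<comment> \<open>The inserted term vanishes, since the potential over zero steps is zero; it
    brings the sum into the martingale form with \<open>m = 0\<close>.\<close>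
  also have "\<dots> = 2 * (\<Sum>u\<in>path_set \<Omega> (Suc k). path_weight p \<pi> (Suc k) u *
      tr_cosh ((\<Sum>i=1..Suc k. h (u i)) + kernel_op \<Omega> p (potential \<Omega> p h 0) (u (Suc k))))"
    by (simp add: k kernel_op_def sum_distrib_left mult_ac)
  also have "\<dots> \<le> 2 * (((1 + R\<^sup>2 / 2) / (1 - R\<^sup>2 / 2)) ^ Suc k * DIM('v))"
    by (intro mult_left_mono path_tr_cosh_martingale[OF row e e0 pi stat sa h osc R]) auto
  finally show ?thesis by (simp add: k mult.assoc)
qed

section \<open>Hermitian matrices\<close>

text \<open>The inner product on \<open>complex ^ 'd\<close> is the real part of the Hermitian one.
  Moving an entry to the other side conjugates it, and conjugating an entry of a Hermitian matrix
  transposes it.\<close>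

lemma hermitian_inner:
  assumes "hermitian A"
  shows "(A *v x) \<bullet> y = x \<bullet> (A *v y)"
proof -
  have entry: "(A $ i $ j * z) \<bullet> w = z \<bullet> (A $ j $ i * w)" for i j z w
  proof -
    have "A $ j $ i = cnj (A $ i $ j)" using assms unfolding hermitian_def by blast
    then show ?thesis by (simp add: inner_complex_def algebra_simps)
  qed
  have "(A *v x) \<bullet> y = (\<Sum>i\<in>UNIV. \<Sum>j\<in>UNIV. x $ j \<bullet> (A $ j $ i * y $ i))"
    by (simp add: inner_vec_def matrix_vector_mult_def inner_sum_left entry)
  also have "\<dots> = (\<Sum>j\<in>UNIV. \<Sum>i\<in>UNIV. x $ j \<bullet> (A $ j $ i * y $ i))"
    by (rule sum.swap)
  finally show ?thesis
    by (simp add: inner_vec_def matrix_vector_mult_def inner_sum_right)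
qed

text \<open>As a bounded real-linear operator a matrix carries the operator norm, and the spectral
  theorem above applies to it.\<close>

definition matrix_op :: "complex ^ 'n ^ 'm \<Rightarrow> (complex ^ 'n) \<Rightarrow>\<^sub>L (complex ^ 'm)" where
  "matrix_op A = Blinfun (\<lambda>v. A *v v)"

lemma matrix_op_apply [simp]: "matrix_op A v = A *v v"
  by (simp add: matrix_op_def bounded_linear_Blinfun_apply)

lemma norm_matrix_op: "norm (matrix_op A) = op_norm A"
proof -
  have "blinfun_apply (matrix_op A) = (*v) A" by (rule ext) simp
  then show ?thesis by (simp add: norm_blinfun.rep_eq op_norm_def)
qed

lemma self_adjoint_matrix_op: "hermitian A \<Longrightarrow> self_adjoint (matrix_op A)"
  by (simp add: self_adjoint_def hermitian_inner)

lemma matrix_op_diff: "matrix_op (A - B) = matrix_op A - matrix_op B"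
  by (rule blinfun_eqI) (simp add: blinfun.diff_left matrix_vector_mult_diff_rdistrib)

lemma matrix_op_scaleR: "matrix_op (c *\<^sub>R A) = c *\<^sub>R matrix_op A"
  by (rule blinfun_eqI)
     (simp add: blinfun.scaleR_left vec_eq_iff matrix_vector_mult_def scaleR_sum_right)

lemma matrix_op_add: "matrix_op (A + B) = matrix_op A + matrix_op B"
  by (rule blinfun_eqI) (simp add: blinfun.add_left matrix_vector_mult_add_rdistrib)

lemma matrix_op_zero: "matrix_op 0 = 0"
  by (rule blinfun_eqI) simp

lemma matrix_op_sum: "matrix_op (sum f I) = (\<Sum>i\<in>I. matrix_op (f i))"
  by (induction I rule: infinite_finite_induct) (auto simp: matrix_op_zero matrix_op_add)

lemma hermitian_stationary_mean:
  assumes "\<And>x. x \<in> \<Omega> \<Longrightarrow> hermitian (g x)"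
  shows "hermitian (stationary_mean \<Omega> \<pi> g)"
  unfolding hermitian_def
proof (intro allI)
  fix i j
  have "g x $ i $ j = cnj (g x $ j $ i)" if "x \<in> \<Omega>" for x
    using assms[OF that] unfolding hermitian_def by blast
  then have "(\<Sum>x\<in>\<Omega>. \<pi> x *\<^sub>R g x $ i $ j) = (\<Sum>x\<in>\<Omega>. \<pi> x *\<^sub>R cnj (g x $ j $ i))"
    by (intro sum.cong) simp_all
  then show "stationary_mean \<Omega> \<pi> g $ i $ j = cnj (stationary_mean \<Omega> \<pi> g $ j $ i)"
    by (simp add: stationary_mean_def)
qed

lemma hermitian_diff: "hermitian A \<Longrightarrow> hermitian B \<Longrightarrow> hermitian (A - B)"
  unfolding hermitian_def by (metis complex_cnj_diff vector_minus_component)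

section \<open>The empirical mean\<close>

text \<open>The law of \<open>U\<close> is a point measure on a finite set, so integrability is
  automatic and expectations over \<open>M\<close> reduce to path sums.\<close>

lemma path_law_integral:
  fixes F :: "(nat \<Rightarrow> 'a) \<Rightarrow> real"
  assumes fin: "finite \<Omega>"
    and pi: "\<And>x. x \<in> \<Omega> \<Longrightarrow> 0 \<le> \<pi> x" and p: "\<And>x y. x \<in> \<Omega> \<Longrightarrow> y \<in> \<Omega> \<Longrightarrow> 0 \<le> p x y"
    and n: "n \<ge> 1"
    and U: "U \<in> measurable M (count_space (path_set \<Omega> n))"
    and law: "distr M (count_space (path_set \<Omega> n)) U = path_law \<Omega> p \<pi> n"
  shows "integrable M (\<lambda>\<omega>. F (U \<omega>))"
    and "(\<integral>\<omega>. F (U \<omega>) \<partial>M) = (\<Sum>u\<in>path_set \<Omega> n. path_weight p \<pi> n u * F u)"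
proof -
  have fin': "finite (path_set \<Omega> n)"
    unfolding path_set_def by (intro finite_PiE fin) auto
  have law': "distr M (count_space (path_set \<Omega> n)) U
      = point_measure (path_set \<Omega> n) (\<lambda>u. ennreal (path_weight p \<pi> n u))"
    unfolding law path_law_def path_weight_def ..
  show "integrable M (\<lambda>\<omega>. F (U \<omega>))"
    by (rule integrable_distr[OF U]) (simp add: law' integrable_point_measure_finite fin')
  have "(\<integral>\<omega>. F (U \<omega>) \<partial>M) = integral\<^sup>L (distr M (count_space (path_set \<Omega> n)) U) F"
    by (rule integral_distr[OF U, symmetric]) simp
  also have "\<dots> = (\<Sum>u\<in>path_set \<Omega> n. path_weight p \<pi> n u * F u)"
    unfolding law' using n
    by (subst lebesgue_integral_point_measure_finite[OF fin'])
       (auto intro!: path_weight_nonneg[OF pi p])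
  finally show "(\<integral>\<omega>. F (U \<omega>) \<partial>M) = (\<Sum>u\<in>path_set \<Omega> n. path_weight p \<pi> n u * F u)" .
qed

section \<open>The Dobrushin coefficient and numerical constants\<close>

lemma min_entry_le:
  assumes "finite \<Omega>" "x \<in> \<Omega>" "y \<in> \<Omega>"
  shows "min_entry \<Omega> p \<le> p x y"
  unfolding min_entry_def using assms by (intro Min_le) (auto intro!: image_eqI[of _ _ "(x, y)"])

text \<open>The upper bound rests on \<open>\<bar>s - t\<bar> = s + t - 2 * min s t\<close>, with
  the minimum bounded below by \<open>min_entry\<close>, and on rows summing to 1.\<close>

lemma
  assumes fin: "finite \<Omega>" and ne: "\<Omega> \<noteq> {}" and kernel: "markov_kernel \<Omega> p"
  shows dobrushin_nonneg: "0 \<le> dobrushin \<Omega> p"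
    and dobrushin_le: "dobrushin \<Omega> p \<le> 1 - real (card \<Omega>) * min_entry \<Omega> p"
proof -
  let ?f = "\<lambda>(x, y). 1 / 2 * (\<Sum>z\<in>\<Omega>. \<bar>p x z - p y z\<bar>)"
  have im: "finite (?f ` (\<Omega> \<times> \<Omega>))" "?f ` (\<Omega> \<times> \<Omega>) \<noteq> {}"
    using fin ne by auto
  have "dobrushin \<Omega> p \<in> ?f ` (\<Omega> \<times> \<Omega>)"
    unfolding dobrushin_def by (rule Max_in[OF im])
  then obtain x y where xy: "x \<in> \<Omega>" "y \<in> \<Omega>"
    and d: "dobrushin \<Omega> p = 1 / 2 * (\<Sum>z\<in>\<Omega>. \<bar>p x z - p y z\<bar>)"
    by auto
  show "0 \<le> dobrushin \<Omega> p" unfolding d by (simp add: sum_nonneg)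
  have "(\<Sum>z\<in>\<Omega>. \<bar>p x z - p y z\<bar>) \<le> (\<Sum>z\<in>\<Omega>. p x z + p y z - 2 * min_entry \<Omega> p)"
    using min_entry_le[OF fin, of x _ p] min_entry_le[OF fin, of y _ p] xy
    by (intro sum_mono) (smt (verit))
  also have "\<dots> = 2 - 2 * (real (card \<Omega>) * min_entry \<Omega> p)"
    using kernel xy by (simp add: markov_kernel_def sum.distrib sum_subtractf)
  finally show "dobrushin \<Omega> p \<le> 1 - real (card \<Omega>) * min_entry \<Omega> p"
    unfolding d by simp
qed

text \<open>The factor is at most \<open>1 + 4 * \<rho> \<le> exp (4 * \<rho>)\<close>, so its power
  is at most \<open>exp (1 / 16)\<close>. The value \<open>3 / 2\<close> is what the final constant
  6 leaves room for.\<close>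

lemma growth_factor_power_bound:
  fixes \<rho> :: real
  assumes "0 \<le> \<rho>" "64 * real n * \<rho> \<le> 1" "n \<ge> 1"
  shows "((1 + \<rho>) / (1 - \<rho>)) ^ n \<le> 3 / 2"
proof -
  have "64 * \<rho> \<le> 64 * real n * \<rho>" using assms by (simp add: mult_right_mono)
  then have \<rho>: "64 * \<rho> \<le> 1" using assms by linarith
  have "(1 + \<rho>) / (1 - \<rho>) \<le> 1 + 4 * \<rho>"
  proof -
    have "4 * \<rho> * \<rho> \<le> 4 * \<rho> * (1 / 64)" using \<rho> assms by (intro mult_left_mono) auto
    then have "1 + \<rho> \<le> (1 + 4 * \<rho>) * (1 - \<rho>)" using assms by (simp add: algebra_simps)
    then show ?thesis using \<rho> by (simp add: divide_le_eq)
  qed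
  also have "\<dots> \<le> exp (4 * \<rho>)" by (rule exp_ge_add_one_self)
  finally have "((1 + \<rho>) / (1 - \<rho>)) ^ n \<le> exp (4 * \<rho>) ^ n"
    using \<rho> assms by (intro power_mono) auto
  also have "\<dots> = exp (4 * real n * \<rho>)" by (simp add: exp_of_nat_mult[symmetric] mult_ac)
  also have "\<dots> \<le> exp (1 / 16)" using assms by simp
  also have "\<dots> \<le> 3 / 2" using exp_bound[of "1 / 16"] by (simp add: power2_eq_square)
  finally show ?thesis .
qed

text \<open>The path estimate is applied to the centred observable scaled by \<open>a / n\<close>,
  whose sum along a path is \<open>a\<close> times the deviation of the empirical mean.\<close>

lemma empirical_mean_exp_moment:
  fixes g :: "'a \<Rightarrow> complex ^ 'd ^ 'd"
  assumes fin: "finite \<Omega>" and card: "card \<Omega> \<ge> 2"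
    and kernel: "markov_kernel \<Omega> p"
    and stat: "stationary_distribution \<Omega> p \<pi>"
    and min: "min_entry \<Omega> p > 0"
    and n: "n \<ge> 1"
    and herm: "\<And>x. x \<in> \<Omega> \<Longrightarrow> hermitian (g x)"
    and bound: "\<And>x. x \<in> \<Omega> \<Longrightarrow> op_norm (g x) \<le> 1"
  shows "(\<Sum>u\<in>path_set \<Omega> n. path_weight p \<pi> n u *
      exp (sqrt (kappa \<Omega> p * real n / 2) * op_norm (empirical_mean n g u - stationary_mean \<Omega> \<pi> g)))
    \<le> 6 * real CARD('d)"
proof -
  define a where "a = sqrt (kappa \<Omega> p * real n / 2)"
  define e where "e = min_entry \<Omega> p"
  define \<theta> where "\<theta> = a / real n"
  \<comment> \<open>The oscillation of \<open>h\<close> is at most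
    \<open>2 * \<theta> = 2 * e * R\<close>, which is at most \<open>card \<Omega> * e * R\<close>
    because \<open>\<Omega>\<close> has at least two points.\<close>
  define R where "R = \<theta> / e"
  define \<mu> where "\<mu> = stationary_mean \<Omega> \<pi> g"
  define h where "h x = \<theta> *\<^sub>R matrix_op (g x - \<mu>)" for x
  have ne: "\<Omega> \<noteq> {}" using card by auto
  have e0: "e > 0" using min by (simp add: e_def)
  have e: "e \<le> p x y" if "x \<in> \<Omega>" "y \<in> \<Omega>" for x y
    unfolding e_def using that by (rule min_entry_le[OF fin])
  have row: "(\<Sum>y\<in>\<Omega>. p x y) = 1" if "x \<in> \<Omega>" for x
    using kernel that by (simp add: markov_kernel_def)
  have pi: "0 \<le> \<pi> x" if "x \<in> \<Omega>" for x
    using stat that by (simp add: stationary_distribution_def)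
  have pi1: "(\<Sum>x\<in>\<Omega>. \<pi> x) = 1"
    using stat by (simp add: stationary_distribution_def)
  have st: "(\<Sum>x\<in>\<Omega>. \<pi> x * p x y) = \<pi> y" if "y \<in> \<Omega>" for y
    using stat that by (simp add: stationary_distribution_def)
  have n0: "real n > 0" using n by simp
  have \<delta>: "0 \<le> dobrushin \<Omega> p" "dobrushin \<Omega> p \<le> 1 - real (card \<Omega>) * e"
    unfolding e_def by (intro dobrushin_nonneg dobrushin_le fin ne kernel)+
  have ce: "2 * e \<le> real (card \<Omega>) * e" using card e0 by simp
  have k0: "0 \<le> kappa \<Omega> p" by (simp add: kappa_def)
  have \<theta>0: "0 \<le> \<theta>" by (simp add: \<theta>_def a_def k0)
  have R0: "0 \<le> R" using \<theta>0 e0 by (simp add: R_def)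
  \<comment> \<open>Here \<open>R\<^sup>2 = kappa \<Omega> p / (2 * n * e\<^sup>2)\<close>, so
    \<open>n\<close> cancels and the definition of \<open>kappa\<close> leaves a perfect square. Its
    root is at most 1, since \<open>2 * e \<le> card \<Omega> * e \<le> 1\<close>.\<close>
  have R2: "64 * real n * (R\<^sup>2 / 2) \<le> 1"
  proof -
    have "64 * real n * (R\<^sup>2 / 2) = 16 * kappa \<Omega> p / e\<^sup>2"
      using n0 k0 e0
      by (simp add: R_def \<theta>_def a_def power_divide) (simp add: field_simps power2_eq_square)
    also have "\<dots> = (2 * e * (1 - sqrt (dobrushin \<Omega> p)))\<^sup>2"
      using e0 by (simp add: kappa_def e_def[symmetric] power_mult_distrib power_divide) (simp add: eval_nat_numeral)
    also have "\<dots> \<le> 1"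
    proof -
      have "dobrushin \<Omega> p \<le> 1" "2 * e \<le> 1"
        using \<delta> ce e0 by linarith+
      then have "0 \<le> sqrt (dobrushin \<Omega> p)" "sqrt (dobrushin \<Omega> p) \<le> 1" "2 * e \<le> 1"
        using \<delta>(1) by auto
      then have "0 \<le> 2 * e * (1 - sqrt (dobrushin \<Omega> p))" "2 * e * (1 - sqrt (dobrushin \<Omega> p)) \<le> 1"
        using e0 mult_mono[of "2 * e" 1 "1 - sqrt (dobrushin \<Omega> p)" 1] by auto
      then show ?thesis by (simp add: power_le_one)
    qed
    finally show ?thesis .
  qed
  have R1: "R\<^sup>2 / 2 < 1"
  proof -
    have "64 * (R\<^sup>2 / 2) \<le> 64 * real n * (R\<^sup>2 / 2)" using n by (intro mult_right_mono) auto
    with R2 show ?thesis by linarith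
  qed
  have sa: "self_adjoint (h x)" if "x \<in> \<Omega>" for x
    unfolding h_def \<mu>_def using that
    by (intro self_adjoint_scaleR self_adjoint_matrix_op hermitian_diff hermitian_stationary_mean herm)
  have mean: "(\<Sum>x\<in>\<Omega>. \<pi> x *\<^sub>R h x) = 0"
  proof -
    have "(\<Sum>x\<in>\<Omega>. \<pi> x *\<^sub>R h x) = \<theta> *\<^sub>R (\<Sum>x\<in>\<Omega>. \<pi> x *\<^sub>R (matrix_op (g x) - matrix_op \<mu>))"
      by (simp add: h_def matrix_op_diff scaleR_sum_right mult.commute)
    also have "(\<Sum>x\<in>\<Omega>. \<pi> x *\<^sub>R (matrix_op (g x) - matrix_op \<mu>)) = 0"
      by (simp add: scaleR_diff_right sum_subtractf scaleR_sum_left[symmetric] pi1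
          \<mu>_def stationary_mean_def matrix_op_sum matrix_op_scaleR)
    finally show ?thesis by simp
  qed
  have osc: "norm (h x - h y) \<le> real (card \<Omega>) * e * R" if "x \<in> \<Omega>" "y \<in> \<Omega>" for x y
  proof -
    have "h x - h y = \<theta> *\<^sub>R (matrix_op (g x) - matrix_op (g y))"
      by (simp add: h_def matrix_op_diff scaleR_diff_right)
    then have "norm (h x - h y) = \<theta> * norm (matrix_op (g x) - matrix_op (g y))"
      using \<theta>0 by simp
    also have "\<dots> \<le> \<theta> * 2"
      using norm_triangle_ineq4[of "matrix_op (g x)" "matrix_op (g y)"] bound[OF that(1)] bound[OF that(2)]
      by (intro mult_left_mono \<theta>0) (simp add: norm_matrix_op)
    also have "\<dots> = 2 * e * R" using e0 by (simp add: R_def)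
    also have "\<dots> \<le> real (card \<Omega>) * e * R" by (intro mult_right_mono ce R0)
    finally show ?thesis .
  qed
  have "norm (\<Sum>i=1..n. h (u i)) = a * op_norm (empirical_mean n g u - \<mu>)" for u
  proof -
    have "(\<Sum>i=1..n. h (u i)) = \<theta> *\<^sub>R ((\<Sum>i=1..n. matrix_op (g (u i))) - real n *\<^sub>R matrix_op \<mu>)"
      by (simp add: h_def matrix_op_diff scaleR_sum_right[symmetric] sum_subtractf
          sum_constant_scaleR)
    also have "\<dots> = a *\<^sub>R matrix_op (empirical_mean n g u - \<mu>)"
      using n0 by (simp add: \<theta>_def empirical_mean_def matrix_op_diff matrix_op_scaleR matrix_op_sum
          scaleR_diff_right)
    finally show ?thesis by (simp add: norm_matrix_op a_def k0)
  qed
  then have "(\<Sum>u\<in>path_set \<Omega> n. path_weight p \<pi> n u * exp (a * op_norm (empirical_mean n g u - \<mu>)))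
      \<le> 2 * ((1 + R\<^sup>2 / 2) / (1 - R\<^sup>2 / 2)) ^ n * DIM(complex ^ 'd)"
    using path_exp_norm_sum[OF row e less_imp_le[OF e0] pi pi1 st sa mean osc R0 R1 n] by simp
  \<comment> \<open>The real dimension of \<open>complex ^ 'd\<close> is twice
    \<open>CARD('d)\<close>, so the constant is \<open>2 * (3 / 2) * 2 = 6\<close>.\<close>
  also have "\<dots> \<le> 2 * (3 / 2) * DIM(complex ^ 'd)"
    by (intro mult_right_mono mult_left_mono growth_factor_power_bound R2 n) auto
  finally show ?thesis by (simp add: a_def \<mu>_def)
qed

section \<open>Tail and mean bounds for the empirical mean\<close>

theorem corollary8p2:
  fixes \<Omega> :: "'a set" and p :: "'a \<Rightarrow> 'a \<Rightarrow> real" and \<pi> :: "'a \<Rightarrow> real"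
    and n :: nat
    and M :: "'b measure" and U :: "'b \<Rightarrow> nat \<Rightarrow> 'a"
    and g :: "'a \<Rightarrow> complex ^ 'd ^ 'd"
  assumes "finite \<Omega>" and "card \<Omega> \<ge> 2"
    and "markov_kernel \<Omega> p"
    and "stationary_distribution \<Omega> p \<pi>"
    and "reversible_kernel \<Omega> p \<pi>"
    and "min_entry \<Omega> p > 0"
    and "n \<ge> 2"
    and "prob_space M"
    and "U \<in> measurable M (count_space (path_set \<Omega> n))"
    and "distr M (count_space (path_set \<Omega> n)) U = path_law \<Omega> p \<pi> n"
    and "\<And>x. x \<in> \<Omega> \<Longrightarrow> hermitian (g x)"
    and "(MAX x\<in>\<Omega>. op_norm (g x)) \<le> 1"
  shows "(\<forall>t>0. measure M {\<omega> \<in> space M. op_norm (empirical_mean n g (U \<omega>) - stationary_mean \<Omega> \<pi> g) \<ge> t}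
            \<le> 6 * real CARD('d) * exp (- (sqrt (kappa \<Omega> p * real n / 2) * t)))
       \<and> (\<integral>\<omega>. op_norm (empirical_mean n g (U \<omega>) - stationary_mean \<Omega> \<pi> g) \<partial>M)
            \<le> ln (6 * exp 1 * real CARD('d)) * sqrt (2 / (kappa \<Omega> p * real n))"
proof -
  interpret prob_space M by fact
  define a where "a = sqrt (kappa \<Omega> p * real n / 2)"
  define D where "D = 6 * real CARD('d)"
  define Z where "Z u = op_norm (empirical_mean n g u - stationary_mean \<Omega> \<pi> g)" for u
  have \<Omega>: "\<Omega> \<noteq> {}" using assms(2) by auto
  have bound: "op_norm (g x) \<le> 1" if "x \<in> \<Omega>" for x
  proof -
    have "op_norm (g x) \<le> (MAX x\<in>\<Omega>. op_norm (g x))"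
      using assms(1) that by (intro Max_ge) auto
    with assms(12) show ?thesis by linarith
  qed
  have pi: "0 \<le> \<pi> x" if "x \<in> \<Omega>" for x
    using assms(4) that by (simp add: stationary_distribution_def)
  have p: "0 \<le> p x y" if "x \<in> \<Omega>" "y \<in> \<Omega>" for x y
    using assms(3) that by (simp add: markov_kernel_def)
  have n: "n \<ge> 1" using assms(7) by simp
  note int = path_law_integral[OF assms(1) pi p n assms(9,10)]
  have D: "1 \<le> D" using zero_less_card_finite[where 'a = 'd] unfolding D_def by linarith
  \<comment> \<open>A positive minimal entry forces the Dobrushin coefficient below 1, so
    \<open>a\<close> is positive and can be divided by.\<close>
  have \<kappa>: "0 < kappa \<Omega> p"
  proof -
    have "0 < real (card \<Omega>) * min_entry \<Omega> p" using assms(2,6) by simp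
    then have "sqrt (dobrushin \<Omega> p) < 1"
      using dobrushin_le[OF assms(1) \<Omega> assms(3)] by simp
    then show ?thesis using assms(6) by (simp add: kappa_def)
  qed
  have a: "0 < a" using \<kappa> n by (simp add: a_def)
  have moment: "expectation (\<lambda>\<omega>. exp (a * Z (U \<omega>))) \<le> D"
    using int(2)[of "\<lambda>u. exp (a * Z u)"]
      empirical_mean_exp_moment[OF assms(1-4,6) n assms(11) bound]
    by (simp add: a_def D_def Z_def)
  have "measure M {\<omega> \<in> space M. Z (U \<omega>) \<ge> t} \<le> D * exp (- (a * t))" for t
  proof -
    \<comment> \<open>Chernoff's method: Markov's inequality for the exponential moment.\<close>
    have "measure M {\<omega> \<in> space M. Z (U \<omega>) \<ge> t}
        = measure M {\<omega> \<in> space M. exp (a * Z (U \<omega>)) \<ge> exp (a * t)}"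
      using a by simp
    also have "\<dots> \<le> expectation (\<lambda>\<omega>. exp (a * Z (U \<omega>))) / exp (a * t)"
      by (rule integral_Markov_inequality_measure[where A = "space M", OF int(1)[of "\<lambda>u. exp (a * Z u)"]]) auto
    also have "\<dots> \<le> D / exp (a * t)"
      by (intro divide_right_mono moment) simp
    finally show ?thesis by (simp add: exp_minus divide_inverse)
  qed
  moreover have "expectation (\<lambda>\<omega>. Z (U \<omega>)) \<le> ln (6 * exp 1 * real CARD('d)) * sqrt (2 / (kappa \<Omega> p * real n))"
  proof -
    \<comment> \<open>The tangent inequality \<open>1 + s \<le> exp s\<close> at
      \<open>s = a * Z u - ln D\<close> plays the role of Jensen's inequality; integrating it gives
      a mean of at most \<open>ln D / a\<close>.\<close>
    have "a * Z u - ln D \<le> exp (a * Z u) / D - 1" for u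
      using exp_ge_add_one_self[of "a * Z u - ln D"] D by (simp add: exp_diff)
    then have "expectation (\<lambda>\<omega>. a * Z (U \<omega>) - ln D) \<le> expectation (\<lambda>\<omega>. exp (a * Z (U \<omega>)) / D - 1)"
      using int(1)[of "\<lambda>u. a * Z u - ln D"] int(1)[of "\<lambda>u. exp (a * Z u) / D - 1"]
      by (intro integral_mono)
    also have "\<dots> = expectation (\<lambda>\<omega>. exp (a * Z (U \<omega>))) / D - 1"
      using int(1)[of "\<lambda>u. exp (a * Z u)"] by (simp add: prob_space)
    also have "\<dots> \<le> 0" using moment D by simp
    finally have "a * expectation (\<lambda>\<omega>. Z (U \<omega>)) \<le> ln D"
      using int(1)[of Z] by (simp add: prob_space)
    \<comment> \<open>The right-hand side equals \<open>1 + ln D\<close>.\<close>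
    also have "\<dots> \<le> ln (6 * exp 1 * real CARD('d))"
      using D by (simp add: D_def ln_mult)
    finally have "expectation (\<lambda>\<omega>. Z (U \<omega>)) \<le> ln (6 * exp 1 * real CARD('d)) * (1 / a)"
      using a by (simp add: field_simps)
    also have "1 / a = sqrt (2 / (kappa \<Omega> p * real n))"
      by (simp add: a_def real_sqrt_divide)
    finally show ?thesis .
  qed
  ultimately show ?thesis unfolding Z_def a_def D_def by blast
qed

end
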